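(* Let $X$ be a finite set, let $R$ be a commutative ring with unit, and let $r\colon X \to R$ be any function. Then there exists a map $\tau\colon \mathscr{P}(X)\times\mathscr{P}(X)\to R$ such that (i) $\tau(\{x\},\{x\}) = r(x)$ for all $x\in X$; (ii) $\tau(\{x\},\{y\}) = -\tau(\{y\},\{x\})$ for all $x,y\in X$ with $x\neq y$; (iii) $\tau(\varnothing,A)=\tau(A,\varnothing)=1$ for all $A\in\mathscr{P}(X)$; (iv) $\tau(A,B)\,\tau(A\bigtriangleup B,C)=\tau(A,B\bigtriangleup C)\,\tau(B,C)$ for all $A,B,C\in\mathscr{P}(X)$; (v) $\tau(A,B)\in\{-1,1\}$ whenever $A\cap B=\varnothing$.
   Context: $\mathscr{P}(X)$ denotes the set of all subsets of $X$, and $A\bigtriangleup B := (A\cup B)\smallsetminus(A\cap B)$ is the symmetric difference. *)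

theory Defs
  imports "HOL-Algebra.Ring"
begin

end

theory Submission
  imports Defs
begin

text \<open>
  Order \<open>X\<close> linearly, put \<open>w(x,x) = r(x)\<close>, and for \<open>x \<noteq> y\<close> let \<open>w(x,y)\<close> be \<open>-1\<close> or \<open>1\<close> according
  to whether \<open>x\<close> comes after \<open>y\<close>. Then \<open>\<tau>(A,B)\<close>, the product of \<open>w\<close> over \<open>A \<times> B\<close>, works: the
  cocycle identity (iv) can be checked factor by factor on \<open>X \<times> X\<close>, since off the diagonal
  \<open>w\<^sup>2 = 1\<close>, so only parities of exponents matter, and on the diagonal \<open>w(x,x)\<close> occurs at most once
  on either side, namely when \<open>x\<close> lies in at least two of \<open>A\<close>, \<open>B\<close>, \<open>C\<close>.
\<close>

context cring
begin

text \<open>Signs are closed under multiplication; over an infinite \<open>A\<close> the product is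
  \<open>\<one>\<close> by default.\<close>

lemma finprod_pm_one:
  assumes "\<And>x. x \<in> A \<Longrightarrow> f x \<in> {\<ominus> \<one>, \<one>}"
  shows "finprod R f A \<in> {\<ominus> \<one>, \<one>}"
  using assms
proof (induction A rule: infinite_finite_induct)
  case (insert x F)
  then have "f x \<in> {\<ominus> \<one>, \<one>}" "finprod R f F \<in> {\<ominus> \<one>, \<one>}"
    by auto
  moreover have "f \<in> F \<rightarrow> carrier R" "f x \<in> carrier R"
    using insert.prems by fastforce+
  ultimately show ?case
    using insert.hyps by (auto simp: l_minus)
qed simp_all

text \<open>The values of \<open>w\<close> on the diagonal stay arbitrary in \<open>R\<close>, so
  that they can later carry \<open>r\<close>.\<close>

lemma finprod_times_cocycle:
  assumes "finite X" and subs: "A \<subseteq> X" "B \<subseteq> X" "C \<subseteq> X"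
    and w: "w \<in> X \<times> X \<rightarrow> carrier R"
    and sq: "\<And>x y. x \<in> X \<Longrightarrow> y \<in> X \<Longrightarrow> x \<noteq> y \<Longrightarrow> w (x, y) \<otimes> w (x, y) = \<one>"
  shows "finprod R w (A \<times> B) \<otimes> finprod R w (sym_diff A B \<times> C) =
         finprod R w (A \<times> sym_diff B C) \<otimes> finprod R w (B \<times> C)"
proof -
  \<comment> \<open>Padding by \<open>\<one>\<close> turns all four products into products over
    \<open>X \<times> X\<close>, which can then be merged and compared pointwise.\<close>
  define u where "u = (\<lambda>S p. if p \<in> S then w p else \<one>)"
  have u: "u S \<in> X \<times> X \<rightarrow> carrier R" for S
    using w by (auto simp: u_def)
  have ext: "finprod R w S = finprod R (u S) (X \<times> X)" if "S \<subseteq> X \<times> X" for S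
    using that \<open>finite X\<close> w unfolding u_def
    by (intro finprod_mono_neutral_cong_left) auto
  have pointwise: "u (A \<times> B) p \<otimes> u (sym_diff A B \<times> C) p = u (A \<times> sym_diff B C) p \<otimes> u (B \<times> C) p"
    if pX: "p \<in> X \<times> X" for p
  proof -
    obtain x y where p: "p = (x, y)" "x \<in> X" "y \<in> X"
      using pX by auto
    have "w (x, y) \<in> carrier R"
      using p w by auto
    then show ?thesis
      using sq[of x y] p by (cases "x = y") (auto simp: u_def)
  qed
  have "finprod R w (A \<times> B) \<otimes> finprod R w (sym_diff A B \<times> C) =
        finprod R (\<lambda>p. u (A \<times> B) p \<otimes> u (sym_diff A B \<times> C) p) (X \<times> X)"
    using subs by (subst (1 2) ext) (auto intro!: finprod_multf[symmetric] u)
  also have "\<dots> = finprod R (\<lambda>p. u (A \<times> sym_diff B C) p \<otimes> u (B \<times> C) p) (X \<times> X)"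
    by (rule finprod_cong'[OF refl _ pointwise]) (use u in \<open>auto simp: Pi_iff\<close>)
  also have "\<dots> = finprod R w (A \<times> sym_diff B C) \<otimes> finprod R w (B \<times> C)"
    using subs by (subst (1 2) ext) (auto intro!: finprod_multf u)
  finally show ?thesis .
qed

end

theorem lemma2p5:
  fixes X :: "'a set" and R :: "('b, 'm) ring_scheme" (structure) and r :: "'a \<Rightarrow> 'b"
  assumes "finite X"
    and "cring R"
    and "r \<in> X \<rightarrow> carrier R"
  shows "\<exists>\<tau> \<in> Pow X \<times> Pow X \<rightarrow> carrier R.
    (\<forall>x\<in>X. \<tau> ({x}, {x}) = r x) \<and>
    (\<forall>x\<in>X. \<forall>y\<in>X. x \<noteq> y \<longrightarrow> \<tau> ({x}, {y}) = \<ominus> \<tau> ({y}, {x})) \<and>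
    (\<forall>A\<in>Pow X. \<tau> ({}, A) = \<one> \<and> \<tau> (A, {}) = \<one>) \<and>
    (\<forall>A\<in>Pow X. \<forall>B\<in>Pow X. \<forall>C\<in>Pow X.
       \<tau> (A, B) \<otimes> \<tau> (sym_diff A B, C) = \<tau> (A, sym_diff B C) \<otimes> \<tau> (B, C)) \<and>
    (\<forall>A\<in>Pow X. \<forall>B\<in>Pow X. A \<inter> B = {} \<longrightarrow> \<tau> (A, B) \<in> {\<ominus> \<one>, \<one>})"
proof -
  interpret cring R by fact
  \<comment> \<open>\<open>f\<close> encodes the linear order on \<open>X\<close>.\<close>
  obtain f :: "'a \<Rightarrow> nat" where f: "inj_on f X"
    using finite_imp_inj_to_nat_seg[OF \<open>finite X\<close>] by blast
  define w where "w = (\<lambda>(x, y). if x = y then r x else if f y < f x then \<ominus> \<one> else \<one>)"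
  define \<tau> where "\<tau> = (\<lambda>(A, B). finprod R w (A \<times> B))"
  have w: "w \<in> X \<times> X \<rightarrow> carrier R"
    using assms(3) by (auto simp: w_def)
  have single: "\<tau> ({x}, {y}) = w (x, y)" if "x \<in> X" "y \<in> X" for x y
    using that w by (auto simp: \<tau>_def Pi_iff)
  have closed: "\<tau> \<in> Pow X \<times> Pow X \<rightarrow> carrier R"
  proof
    fix p assume "p \<in> Pow X \<times> Pow X"
    then show "\<tau> p \<in> carrier R"
      using w by (cases p) (auto simp: \<tau>_def intro!: finprod_closed)
  qed
  \<comment> \<open>Injectivity of \<open>f\<close> rules out ties, so exactly one of the pairs
    \<open>(x, y)\<close> and \<open>(y, x)\<close> gets \<open>\<ominus> \<one>\<close> by the
    definition of \<open>w\<close>.\<close>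
  have anti: "\<tau> ({x}, {y}) = \<ominus> \<tau> ({y}, {x})" if "x \<in> X" "y \<in> X" "x \<noteq> y" for x y
    using that inj_onD[OF f, of x y] by (auto simp: single w_def)
  have cocycle: "\<tau> (A, B) \<otimes> \<tau> (sym_diff A B, C) = \<tau> (A, sym_diff B C) \<otimes> \<tau> (B, C)"
    if "A \<subseteq> X" "B \<subseteq> X" "C \<subseteq> X" for A B C
    unfolding \<tau>_def prod.case
    by (rule finprod_times_cocycle[OF \<open>finite X\<close> that w]) (auto simp: w_def l_minus)
  \<comment> \<open>Disjointness keeps \<open>A \<times> B\<close> off the diagonal, where
    \<open>w\<close> takes only signs.\<close>
  have pm: "\<tau> (A, B) \<in> {\<ominus> \<one>, \<one>}" if "A \<inter> B = {}" for A B
    unfolding \<tau>_def prod.case by (rule finprod_pm_one) (use that in \<open>auto simp: w_def\<close>)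
  have unit: "\<tau> ({}, A) = \<one>" "\<tau> (A, {}) = \<one>" for A
    by (simp_all add: \<tau>_def)
  have diag: "\<tau> ({x}, {x}) = r x" if "x \<in> X" for x
    using that by (simp add: single w_def)
  show ?thesis
    by (rule bexI[OF _ closed], intro conjI ballI impI)
      (rule diag anti unit cocycle pm; blast)+
qed

end
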